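(* Let $S$ be a regular finite right restriction EI-Ehresmann semigroup. Then there is an embedding of bi-unary semigroups $\Phi:S\to\mathcal{PT}_n$ for $n=|S|$, i.e. an injective map with $\Phi(ab)=\Phi(a)\Phi(b)$, $\Phi(a^{*})=\Phi(a)^{*}$ and $\Phi(a^{+})=\Phi(a)^{+}$ for all $a,b\in S$.
   Context: A subsemilattice $E$ of a semigroup $S$ is a commutative subsemigroup of idempotents. Define equivalences on $S$: $a\,\widetilde{\mathcal L}_E\, b$ iff for all $e\in E$ ($ae=a\Leftrightarrow be=b$); $a\,\widetilde{\mathcal R}_E\, b$ iff for all $e\in E$ ($ea=a\Leftrightarrow eb=b$); $\widetilde{\mathcal H}_E=\widetilde{\mathcal L}_E\cap\widetilde{\mathcal R}_E$. $S$ is ($E$-)Ehresmann if every $\widetilde{\mathcal L}_E$-class and every $\widetilde{\mathcal R}_E$-class contains a unique element of $E$ (denoted $a^{*}$, resp. $a^{+}$, for the class of $a$), $\widetilde{\mathcal L}_E$ is a right congruence and $\widetilde{\mathcal R}_E$ is a left congruence. It is right restriction if $ea=a(ea)^{*}$ for all $a\in S$, $e\in E$. The category $\mathbf C(S)$ has object set $E$ and one morphism $C(a)$ for each $a\in S$, with domain $a^{*}$ and range $a^{+}$, and $C(b)C(a)=C(ba)$ when defined. $S$ is EI-Ehresmann if every endomorphism in $\mathbf C(S)$ is an isomorphism; equivalently, the $\widetilde{\mathcal H}_E$-class of every $e\in E$ is a group. $S$ is regular if every $a\in S$ satisfies $aba=a$ for some $b\in S$. $\mathcal{PT}_n$ is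 the monoid of all partial functions on $\{1,\dots,n\}$, composed from right to left, with $t^{*}=\mathrm{id}_{\operatorname{dom}(t)}$ and $t^{+}=\mathrm{id}_{\operatorname{im}(t)}$, where $\mathrm{id}_A$ is the partial identity on $A$. *)

theory Defs
  imports Main
begin

text \<open>
  The semigroup \<open>S\<close> is a type of class \<^class>\<open>semigroup_mult\<close>; the distinguished
  subsemilattice is an explicit set \<open>E\<close>, on which all notions depend.
\<close>

definition subsemilattice :: "'a::semigroup_mult set \<Rightarrow> bool" where
  "subsemilattice E \<longleftrightarrow>
     (\<forall>e\<in>E. \<forall>f\<in>E. e * f \<in> E) \<and> (\<forall>e\<in>E. \<forall>f\<in>E. e * f = f * e) \<and> (\<forall>e\<in>E. e * e = e)"

definition L_tilde :: "'a::semigroup_mult set \<Rightarrow> ('a \<times> 'a) set" where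
  "L_tilde E = {(a, b). \<forall>e\<in>E. a * e = a \<longleftrightarrow> b * e = b}"

definition R_tilde :: "'a::semigroup_mult set \<Rightarrow> ('a \<times> 'a) set" where
  "R_tilde E = {(a, b). \<forall>e\<in>E. e * a = a \<longleftrightarrow> e * b = b}"

definition right_congruence :: "('a::semigroup_mult \<times> 'a) set \<Rightarrow> bool" where
  "right_congruence r \<longleftrightarrow> equiv UNIV r \<and> (\<forall>a b c. (a, b) \<in> r \<longrightarrow> (a * c, b * c) \<in> r)"

definition left_congruence :: "('a::semigroup_mult \<times> 'a) set \<Rightarrow> bool" where
  "left_congruence r \<longleftrightarrow> equiv UNIV r \<and> (\<forall>a b c. (a, b) \<in> r \<longrightarrow> (c * a, c * b) \<in> r)"

definition Ehresmann :: "'a::semigroup_mult set \<Rightarrow> bool" where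
  "Ehresmann E \<longleftrightarrow> subsemilattice E \<and>
     (\<forall>C \<in> UNIV // L_tilde E. \<exists>!e. e \<in> E \<and> e \<in> C) \<and>
     (\<forall>C \<in> UNIV // R_tilde E. \<exists>!e. e \<in> E \<and> e \<in> C) \<and>
     right_congruence (L_tilde E) \<and> left_congruence (R_tilde E)"

text \<open>The elements \<open>a\<^sup>*\<close> and \<open>a\<^sup>+\<close>; meaningful only if \<^term>\<open>Ehresmann E\<close>.\<close>

definition star_op :: "'a::semigroup_mult set \<Rightarrow> 'a \<Rightarrow> 'a" where
  "star_op E a = (THE e. e \<in> E \<and> e \<in> L_tilde E `` {a})"

definition plus_op :: "'a::semigroup_mult set \<Rightarrow> 'a \<Rightarrow> 'a" where
  "plus_op E a = (THE e. e \<in> E \<and> e \<in> R_tilde E `` {a})"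

definition right_restriction :: "'a::semigroup_mult set \<Rightarrow> bool" where
  "right_restriction E \<longleftrightarrow> Ehresmann E \<and> (\<forall>a. \<forall>e\<in>E. e * a = a * star_op E (e * a))"

text \<open>
  Raw data of a small category. \<open>Comp g f\<close> is the composite of \<open>f\<close> followed by \<open>g\<close> and is
  meaningful only when \<open>Dom g = Cod f\<close>.
\<close>

record ('o, 'm) cat_data =
  Obj :: "'o set"
  Mor :: "'m set"
  Dom :: "'m \<Rightarrow> 'o"
  Cod :: "'m \<Rightarrow> 'o"
  Ident :: "'o \<Rightarrow> 'm"
  Comp :: "'m \<Rightarrow> 'm \<Rightarrow> 'm"

definition iso_mor :: "('o, 'm) cat_data \<Rightarrow> 'm \<Rightarrow> bool" where
  "iso_mor K f \<longleftrightarrow> f \<in> Mor K \<and>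
     (\<exists>g\<in>Mor K. Dom K g = Cod K f \<and> Cod K g = Dom K f \<and>
        Comp K g f = Ident K (Dom K f) \<and> Comp K f g = Ident K (Cod K f))"

definition EI_category :: "('o, 'm) cat_data \<Rightarrow> bool" where
  "EI_category K \<longleftrightarrow> (\<forall>f\<in>Mor K. Dom K f = Cod K f \<longrightarrow> iso_mor K f)"

text \<open>
  The category \<open>C(S)\<close>. Its morphisms \<open>C(a)\<close> correspond bijectively to the elements \<open>a\<close>, so the
  elements themselves serve as morphisms; the identity at the object \<open>e\<close> is \<open>C(e)\<close>.
\<close>

definition cat_of :: "'a::semigroup_mult set \<Rightarrow> ('a, 'a) cat_data" where
  "cat_of E = \<lparr>Obj = E, Mor = UNIV, Dom = star_op E, Cod = plus_op E,
     Ident = (\<lambda>e. e), Comp = (\<lambda>b a. b * a)\<rparr>"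

definition EI_Ehresmann :: "'a::semigroup_mult set \<Rightarrow> bool" where
  "EI_Ehresmann E \<longleftrightarrow> Ehresmann E \<and> EI_category (cat_of E)"

definition regular_semigroup :: "'a::semigroup_mult itself \<Rightarrow> bool" where
  "regular_semigroup _ \<longleftrightarrow> (\<forall>a::'a. \<exists>b. a * b * a = a)"

text \<open>
  Partial functions on \<open>{1..n}\<close> are maps \<^typ>\<open>nat \<rightharpoonup> nat\<close>; right-to-left composition is
  \<^const>\<open>map_comp\<close>.
\<close>

definition PT :: "nat \<Rightarrow> (nat \<rightharpoonup> nat) set" where
  "PT n = {t. dom t \<subseteq> {1..n} \<and> ran t \<subseteq> {1..n}}"

definition partial_id :: "nat set \<Rightarrow> (nat \<rightharpoonup> nat)" where
  "partial_id A = (\<lambda>x. if x \<in> A then Some x else None)"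

definition PT_star :: "(nat \<rightharpoonup> nat) \<Rightarrow> (nat \<rightharpoonup> nat)" where
  "PT_star t = partial_id (dom t)"

definition PT_plus :: "(nat \<rightharpoonup> nat) \<Rightarrow> (nat \<rightharpoonup> nat)" where
  "PT_plus t = partial_id (ran t)"

end

(* The embedding is the Wagner-Preston (Cayley) representation: a acts on S by x \<mapsto> a x,
   restricted to those x with a\<^sup>* x = x. For right restriction semigroups it is an injective
   homomorphism that respects \<^sup>*. It respects \<^sup>+ as soon as a\<^sup>+ S \<subseteq> a S. For this, write
   a = a b a and let f = a b, an idempotent with f\<^sup>+ = a\<^sup>+. Right restriction gives f\<^sup>* f = f,
   so f a\<^sup>+ is an idempotent endomorphism of a\<^sup>+ in the category, and EI forces
   f a\<^sup>+ = a\<^sup>+. *)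
theory Submission imports Defs begin

section \<open>Arithmetic of \<open>star\<close> and \<open>plus\<close> in an Ehresmann
  semigroup\<close>

locale ehresmann_semigroup =
  fixes E :: "'a::semigroup_mult set"
  assumes Ehresmann: "Ehresmann E"
begin

abbreviation star :: "'a \<Rightarrow> 'a" where "star \<equiv> star_op E"
abbreviation plus :: "'a \<Rightarrow> 'a" where "plus \<equiv> plus_op E"

lemma E_commute: "e \<in> E \<Longrightarrow> f \<in> E \<Longrightarrow> e * f = f * e"
  and E_idem: "e \<in> E \<Longrightarrow> e * e = e"
  using Ehresmann by (simp_all add: Ehresmann_def subsemilattice_def)

lemma star_in_class: "star a \<in> E \<and> star a \<in> L_tilde E `` {a}"
proof -
  have "\<forall>C \<in> UNIV // L_tilde E. \<exists>!e. e \<in> E \<and> e \<in> C"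
    using Ehresmann by (simp add: Ehresmann_def)
  then have "\<exists>!e. e \<in> E \<and> e \<in> L_tilde E `` {a}"
    by (rule bspec) (rule quotientI, rule UNIV_I)
  then show ?thesis
    unfolding star_op_def by (rule theI')
qed

lemma plus_in_class: "plus a \<in> E \<and> plus a \<in> R_tilde E `` {a}"
proof -
  have "\<forall>C \<in> UNIV // R_tilde E. \<exists>!e. e \<in> E \<and> e \<in> C"
    using Ehresmann by (simp add: Ehresmann_def)
  then have "\<exists>!e. e \<in> E \<and> e \<in> R_tilde E `` {a}"
    by (rule bspec) (rule quotientI, rule UNIV_I)
  then show ?thesis
    unfolding plus_op_def by (rule theI')
qed

lemma star_in_E [simp]: "star a \<in> E"
  and plus_in_E [simp]: "plus a \<in> E"
  by (simp_all add: star_in_class plus_in_class)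

lemma star_L_tilde: "(a, star a) \<in> L_tilde E"
  and plus_R_tilde: "(a, plus a) \<in> R_tilde E"
  using star_in_class[of a] plus_in_class[of a] by simp_all

lemma star_absorb_iff: "e \<in> E \<Longrightarrow> star a * e = star a \<longleftrightarrow> a * e = a"
  using star_L_tilde[of a] unfolding L_tilde_def by blast

lemma plus_absorb_iff: "e \<in> E \<Longrightarrow> e * plus a = plus a \<longleftrightarrow> e * a = a"
  using plus_R_tilde[of a] unfolding R_tilde_def by blast

lemma mult_star [simp]: "a * star a = a"
  using star_absorb_iff[of "star a" a] by (simp add: E_idem)

lemma plus_mult [simp]: "plus a * a = a"
  using plus_absorb_iff[of "plus a" a] by (simp add: E_idem)

text \<open>Related elements have the same right identities in \<open>E\<close>, so
  \<open>star a\<close> and \<open>star b\<close> lie below each other in the semilattice;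
  commutativity makes this order antisymmetric.\<close>

lemma star_eqI:
  assumes "(a, b) \<in> L_tilde E"
  shows "star a = star b"
proof -
  have "a * e = a \<longleftrightarrow> b * e = b" if "e \<in> E" for e
    using assms that unfolding L_tilde_def by blast
  from this[of "star b"] this[of "star a"]
  have "star a * star b = star a" "star b * star a = star b"
    by (simp_all add: star_absorb_iff)
  then show ?thesis
    using E_commute[of "star a" "star b"] by simp
qed

lemma plus_eqI:
  assumes "(a, b) \<in> R_tilde E"
  shows "plus a = plus b"
proof -
  have "e * a = a \<longleftrightarrow> e * b = b" if "e \<in> E" for e
    using assms that unfolding R_tilde_def by blast
  from this[of "plus a"] this[of "plus b"]
  have "plus a * plus b = plus b" "plus b * plus a = plus a"
    by (simp_all add: plus_absorb_iff)
  then show ?thesis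
    using E_commute[of "plus a" "plus b"] by simp
qed

lemma star_of_E [simp]: "e \<in> E \<Longrightarrow> star e = e"
  using star_absorb_iff[of e e] E_commute[of e "star e"] mult_star[of e] by (simp add: E_idem)

text \<open>The congruence axiom at work: multiply the \<open>L_tilde E\<close>-related pair
  \<open>a\<close>, \<open>star a\<close> by \<open>b\<close> on the right.\<close>

lemma star_mult: "star (a * b) = star (star a * b)"
  using Ehresmann star_L_tilde unfolding Ehresmann_def right_congruence_def
  by (blast intro: star_eqI)

lemma plus_mult_right: "plus (a * b) = plus (a * plus b)"
  using Ehresmann plus_R_tilde unfolding Ehresmann_def left_congruence_def
  by (blast intro: plus_eqI)

lemma star_mult_star: "star (a * b) * star b = star (a * b)"
  by (simp add: star_absorb_iff mult.assoc)

section \<open>Partial left translations\<close>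

definition rep :: "'a \<Rightarrow> 'a \<rightharpoonup> 'a" where
  "rep a = (\<lambda>x. if star a * x = x then Some (a * x) else None)"

lemma dom_rep: "dom (rep a) = {x. star a * x = x}"
  by (auto simp: rep_def split: if_splits)

lemma ran_rep: "ran (rep a) = {a * x |x. star a * x = x}"
  by (auto simp: rep_def ran_def)

lemma rep_of_E: "e \<in> E \<Longrightarrow> rep e = (\<lambda>x. if e * x = x then Some x else None)"
  by (auto simp: rep_def)

lemma rep_star: "rep (star a) = (\<lambda>x. if x \<in> dom (rep a) then Some x else None)"
  by (simp add: rep_of_E dom_rep)

text \<open>The domain of \<open>rep a\<close> determines \<open>star a\<close>, and the value at
  the point \<open>star a\<close> is \<open>a * star a = a\<close>.\<close>

lemma inj_rep: "inj rep"
proof (rule injI)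
  fix a b assume eq: "rep a = rep b"
  have "star a * x = x \<longleftrightarrow> star b * x = x" for x
    using arg_cong[OF eq, of dom] by (auto simp: dom_rep)
  from this[of "star a"] this[of "star b"]
  have "star b * star a = star a" "star a * star b = star b"
    by (simp_all add: E_idem)
  then have stars: "star a = star b"
    using E_commute[of "star a" "star b"] by simp
  have "rep a (star a) = Some a" "rep b (star b) = Some b"
    by (simp_all add: rep_def E_idem)
  then show "a = b"
    unfolding eq stars by (metis option.inject)
qed

end

section \<open>Right restriction: products and ranges of translations\<close>

locale right_restriction_semigroup = ehresmann_semigroup +
  assumes restriction: "e \<in> E \<Longrightarrow> e * a = a * star (e * a)"
begin

text \<open>Equality of domains behind \<open>rep_mult\<close>: the right-hand side describes the
  points where \<open>rep b\<close> is defined with value in the domain of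
  \<open>rep a\<close>.\<close>

lemma star_mult_fix_iff:
  "star (a * b) * x = x \<longleftrightarrow> star b * x = x \<and> star a * (b * x) = b * x"
proof
  have comm: "star a * b = b * star (a * b)"
    using restriction[of "star a" b] by (simp flip: star_mult)
  {
    assume fix_x: "star (a * b) * x = x"
    have "star b * star (a * b) = star (a * b)"
      using star_mult_star E_commute by simp
    then have "star b * x = x"
      using fix_x by (metis mult.assoc)
    moreover have "star a * (b * x) = b * x"
      using comm fix_x by (metis mult.assoc)
    ultimately show "star b * x = x \<and> star a * (b * x) = b * x" ..
  next
    assume fix_x: "star b * x = x \<and> star a * (b * x) = b * x"
    \<comment> \<open>A second use of right restriction moves \<open>star (a * b)\<close> to the
      right of \<open>x\<close>, so it remains to show \<open>x * ?g = x\<close>. That can be tested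
      on \<open>b * x\<close> instead, since \<open>star (b * x) = star x\<close>.\<close>
    let ?g = "star (star (a * b) * x)"
    have split_x: "star (a * b) * x = x * ?g"
      by (rule restriction) simp
    then have "b * x * ?g = b * x"
      using comm fix_x by (metis mult.assoc)
    then have "star (b * x) * ?g = star (b * x)"
      by (simp add: star_absorb_iff)
    moreover have "star (b * x) = star x"
      using fix_x star_mult[of b x] by simp
    ultimately show "star (a * b) * x = x"
      using split_x by (simp add: star_absorb_iff)
  }
qed

lemma rep_mult: "rep (a * b) = rep a \<circ>\<^sub>m rep b"
  by (auto simp: fun_eq_iff rep_def map_comp_def star_mult_fix_iff mult.assoc)

lemma idem_mult_plus_eq_plus:
  assumes EI: "EI_category (cat_of E)" and idem: "f * f = f"
  shows "f * plus f = plus f"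
proof -
  let ?e = "plus f"
  \<comment> \<open>Right restriction gives \<open>star f * f = f * star (f * f)\<close>, and
    \<open>f * f = f\<close>.\<close>
  have "star f * f = f"
    using restriction[of "star f" f] idem by (simp flip: star_mult)
  then have "star f * ?e = ?e"
    by (simp add: plus_absorb_iff)
  then have "star (f * ?e) = ?e"
    using star_mult[of f ?e] by simp
  moreover have "plus (f * ?e) = ?e"
    using plus_mult_right[of f f] idem by simp
  moreover have "\<exists>g. g * a = star a" if "star a = plus a" for a
    using EI that unfolding EI_category_def iso_mor_def cat_of_def by auto
  ultimately obtain g where g: "g * (f * ?e) = ?e"
    by metis
  \<comment> \<open>An idempotent with a left inverse is the identity: multiplying this equation by
    \<open>g\<close> on the left leaves \<open>?e * (f * ?e) = ?e\<close>.\<close>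
  have "f * ?e * (f * ?e) = f * ?e"
    using idem by (metis mult.assoc plus_mult)
  moreover have "?e * (f * ?e) = f * ?e"
    by (simp flip: mult.assoc)
  ultimately show ?thesis
    using g by (metis mult.assoc)
qed

lemma rep_plus:
  assumes EI: "EI_category (cat_of E)" and reg: "a * b * a = a"
  shows "rep (plus a) = (\<lambda>x. if x \<in> ran (rep a) then Some x else None)"
proof -
  \<comment> \<open>\<open>a\<close> and \<open>a * b\<close> are right multiples of each other, so
    the same elements of \<open>E\<close> fix them from the left.\<close>
  have "plus (a * b) = plus a"
    by (metis E_commute mult.assoc plus_absorb_iff plus_in_E plus_mult reg)
  moreover have "a * b * (a * b) = a * b"
    using reg by (simp flip: mult.assoc)
  ultimately have factor: "a * b * plus a = plus a"
    using idem_mult_plus_eq_plus[OF EI, of "a * b"] by simp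
  have "plus a * y = y \<longleftrightarrow> y \<in> ran (rep a)" for y
  proof
    assume "plus a * y = y"
    \<comment> \<open>The preimage of \<open>y\<close> is \<open>b * y\<close>, multiplied by
      \<open>star a\<close> to bring it into the domain of \<open>rep a\<close>; as
      \<open>a * star a = a\<close>, its image is unchanged.\<close>
    then have "a * (star a * (b * y)) = y"
      using factor by (metis mult.assoc mult_star)
    moreover have "star a * (star a * (b * y)) = star a * (b * y)"
      by (simp add: E_idem flip: mult.assoc)
    ultimately show "y \<in> ran (rep a)"
      unfolding ran_rep by (smt (verit) mem_Collect_eq)
  next
    assume "y \<in> ran (rep a)"
    then show "plus a * y = y"
      unfolding ran_rep by (auto simp flip: mult.assoc)
  qed
  then show ?thesis
    by (simp add: rep_of_E)
qed

end

section \<open>Transport of partial maps along an injection into the naturals\<close>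

definition relabel :: "('a \<Rightarrow> nat) \<Rightarrow> ('a \<rightharpoonup> 'a) \<Rightarrow> (nat \<rightharpoonup> nat)" where
  "relabel h t = (\<lambda>k. if k \<in> range h then map_option h (t (inv h k)) else None)"

context
  fixes h :: "'a \<Rightarrow> nat"
  assumes inj_h: "inj h"
begin

lemma relabel_apply [simp]: "relabel h t (h x) = map_option h (t x)"
  using inj_h by (simp add: relabel_def)

lemma relabel_outside: "k \<notin> range h \<Longrightarrow> relabel h t k = None"
  by (simp add: relabel_def)

lemma relabel_eqI:
  assumes "\<And>x. relabel h t (h x) = u (h x)" and "\<And>k. k \<notin> range h \<Longrightarrow> u k = None"
  shows "relabel h t = u"
  using assms relabel_outside by (metis ext rangeE)

lemma dom_relabel: "dom (relabel h t) = h ` dom t"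
  by (auto simp: relabel_def dom_def inj_eq[OF inj_h] inv_f_f[OF inj_h] split: if_splits)

lemma ran_relabel: "ran (relabel h t) = h ` ran t"
proof
  show "h ` ran t \<subseteq> ran (relabel h t)"
  proof clarify
    fix y assume "y \<in> ran t"
    then obtain x where "t x = Some y"
      by (auto simp: ran_def)
    then have "relabel h t (h x) = Some (h y)"
      by simp
    then show "h y \<in> ran (relabel h t)"
      by (rule ranI)
  qed
qed (auto simp: relabel_def ran_def split: if_splits)

lemma inj_relabel: "inj (relabel h)"
proof (rule injI, rule ext)
  fix t u x assume "relabel h t = relabel h u"
  then have "map_option h (t x) = map_option h (u x)"
    by (metis relabel_apply)
  then show "t x = u x"
    by (rule injD[OF option.inj_map[OF inj_h]])
qed

lemma relabel_map_comp: "relabel h (t \<circ>\<^sub>m u) = relabel h t \<circ>\<^sub>m relabel h u"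
  by (rule relabel_eqI) (auto simp: map_comp_def relabel_outside split: option.split)

text \<open>Carries the right-hand sides of \<open>rep_star\<close> and \<open>rep_plus\<close> to
  the form used in \<open>PT_star\<close> and \<open>PT_plus\<close>.\<close>

lemma relabel_partial_id:
  "relabel h (\<lambda>x. if x \<in> A then Some x else None) = partial_id (h ` A)"
  using inj_h by (intro relabel_eqI) (auto simp: partial_id_def inj_image_mem_iff)

end

theorem proposition3p11:
  fixes E :: "'a::{semigroup_mult, finite} set"
  assumes "regular_semigroup TYPE('a)"
    and "right_restriction E"
    and "EI_Ehresmann E"
  shows "\<exists>\<Phi> :: 'a \<Rightarrow> (nat \<rightharpoonup> nat).
           inj \<Phi> \<and> (\<forall>a. \<Phi> a \<in> PT (card (UNIV :: 'a set))) \<and>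
           (\<forall>a b. \<Phi> (a * b) = \<Phi> a \<circ>\<^sub>m \<Phi> b) \<and>
           (\<forall>a. \<Phi> (star_op E a) = PT_star (\<Phi> a)) \<and>
           (\<forall>a. \<Phi> (plus_op E a) = PT_plus (\<Phi> a))"
proof -
  interpret right_restriction_semigroup E
    using assms(2) unfolding right_restriction_def by unfold_locales blast+
  obtain h :: "'a \<Rightarrow> nat" where h: "bij_betw h UNIV {1..card (UNIV :: 'a set)}"
    using finite_same_card_bij[of "UNIV :: 'a set" "{1..card (UNIV :: 'a set)}"] by auto
  then have inj_h: "inj h" and range_h: "range h = {1..card (UNIV :: 'a set)}"
    by (auto simp: bij_betw_def)
  let ?\<Phi> = "\<lambda>a. relabel h (rep a)"
  have "inj ?\<Phi>"
    using inj_compose[OF inj_relabel[OF inj_h] inj_rep] by (simp add: comp_def)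
  \<comment> \<open>Relabelled maps are undefined off the range of \<open>h\<close>, which is
    exactly the set of points on which \<open>PT\<close> acts.\<close>
  moreover have "?\<Phi> a \<in> PT (card (UNIV :: 'a set))" for a
    unfolding PT_def range_h[symmetric]
    by (simp add: dom_relabel[OF inj_h] ran_relabel[OF inj_h] image_mono)
  moreover have "?\<Phi> (a * b) = ?\<Phi> a \<circ>\<^sub>m ?\<Phi> b" for a b
    by (simp add: rep_mult relabel_map_comp[OF inj_h])
  moreover have "?\<Phi> (star a) = PT_star (?\<Phi> a)" for a
    by (simp add: rep_star relabel_partial_id[OF inj_h] PT_star_def dom_relabel[OF inj_h])
  moreover have "?\<Phi> (plus a) = PT_plus (?\<Phi> a)" for a
  proof -
    obtain b where "a * b * a = a"
      using assms(1) unfolding regular_semigroup_def by blast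
    moreover have "EI_category (cat_of E)"
      using assms(3) unfolding EI_Ehresmann_def by blast
    ultimately show ?thesis
      by (simp add: rep_plus relabel_partial_id[OF inj_h] PT_plus_def ran_relabel[OF inj_h])
  qed
  ultimately show ?thesis
    by (intro exI[of _ ?\<Phi>]) blast
qed

end
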